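(* Suppose the ellipsoids are separable. FISTA applied to $\min\{f(x)=\frac12\|\mathcal{A}x-b\|^2:x\in\mathcal{C}\}$ from a starting point $x_0$ finds a separating hyperplane in at most $$\frac{54\sqrt2\,\|\mathcal{A}\|\cdot\|x_0-\bar x\|}{\delta_{\mathcal{A}}^2}-1$$ iterations, where $\bar x$ is any element of $\mathcal{S}=\{x\in\mathcal{C}:b-\mathcal{A}x=v_D\}$. That is, for every integer $k\ge 0$ that is at least this quantity, writing $v_k=b-\mathcal{A}x_k=(s_k,t_k,w_k)$ and $m_k=(-s_k+t_k)/2$, one has $w_k^Tz<m_k$ for all $z\in C_1\cup\dots\cup C_j$ and $w_k^Tz>m_k$ for all $z\in D_1\cup\dots\cup D_l$.
   Context: Norms are Euclidean (spectral for matrices). Ellipsoid separation problem (ESP): given nonsingular $d\times d$ real matrices $A_1,\dots,A_j,B_1,\dots,B_l$ and vectors $c_1,\dots,c_j,d_1,\dots,d_l\in\mathbb{R}^d$, let $C_i=\{z:\|A_i^{-1}(z-c_i)\|\le1\}$, $D_i=\{z:\|B_i^{-1}(z-d_i)\|\le 1\}$. Normalization is assumed: $\max\{\max_i\{\|c_i\|,\|A_i\|\},\max_i\{\|d_i\|,\|B_i\|\}\}=1$. The ellipsoids are separable if there are $w\in\mathbb{R}^d$, $s\in\mathbb{R}$ with $w^Tz<s$ on all $C_i$ and $w^Tz>s$ on all $D_i$. $\delta_{\mathcal{A}}$ is the smallest perturbation to the centers $c_i,d_i$ such that the ellipsoids are no longer separable: the infimum of $\epsilon\ge0$ for which there exist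 $\hat c_i,\hat d_i$ with $\|\hat c_i-c_i\|\le\epsilon$ and $\|\hat d_i-d_i\|\le\epsilon$ for all $i$, such that the ellipsoids with centers $\hat c_i,\hat d_i$ and unchanged matrices $A_i,B_i$ are not separable. Let $C_2^{d+1}=\{(\tau,p)\in\mathbb{R}\times\mathbb{R}^d:\|p\|\le\tau\}$ and $\mathcal{C}=C_2^{d+1}\times\cdots\times C_2^{d+1}$ ($j+l$ times). Let $b=(1,1,0)\in\mathbb{R}\times\mathbb{R}\times\mathbb{R}^d$. The matrix $\mathcal{A}\in\mathbb{R}^{(d+2)\times(j+l)(d+1)}$ sends $x=(\lambda_1,p_1,\dots,\lambda_j,p_j,\mu_1,q_1,\dots,\mu_l,q_l)$ ($\lambda_i,\mu_i\in\mathbb{R}$, $p_i,q_i\in\mathbb{R}^d$) to $$\mathcal{A}x=\Big(\sum_{i=1}^j\lambda_i,\ \sum_{i=1}^l\mu_i,\ \sum_{i=1}^j(\lambda_ic_i+A_ip_i)-\sum_{i=1}^l(\mu_id_i-B_iq_i)\Big).$$ PDHG for $\min\{0:\mathcal{A}x=b,\ x\in\mathcal{C}\}$ is the iteration $(x^+,y^+)=T(x,y)$ with $x^+=\mathrm{proj}_{\mathcal{C}}(x-\sigma\mathcal{A}^Ty)$, $y^+=y+\mathcal{A}(2x^+-x)-b$, $0<\sigma<1/\|\mathcal{A}\|^2$. Its infimal displacement vector $(v_R,v_D)$ is the unique element of minimal norm $\|v\|_M=\sqrt{v^TMv}$ in $\mathrm{cl}(\mathrm{Range}(\mathrm{Id}-T))$,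 where $M=\begin{pmatrix}\frac1\sigma I&-\mathcal{A}^T\\-\mathcal{A}&I\end{pmatrix}$. FISTA: with $L=\|\mathcal{A}\|^2$, $y_0=x_0$, $t_0=1$ (here $t_k$ denotes the FISTA momentum scalars, unrelated to the component $t_k$ of $v_k$), iterate $x_{k+1}=\mathrm{proj}_{\mathcal{C}}(y_k+\frac1L\mathcal{A}^T(b-\mathcal{A}y_k))$, $t_{k+1}=\frac{1+\sqrt{1+4t_k^2}}2$, $y_{k+1}=x_{k+1}+\frac{t_k-1}{t_{k+1}}(x_{k+1}-x_k)$. *)

theory Defs
  imports "HOL-Analysis.Analysis"
begin

text \<open>
  The numbers of ellipsoids \<open>j\<close>, \<open>l\<close> and the dimension \<open>d\<close> are the cardinalities of the finite
  (nonempty) index types \<open>'j\<close>, \<open>'l\<close>, \<open>'d\<close>. All norms below are the Euclidean norms of the library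
  instances for vectors and products; the spectral norm of a matrix is \<^const>\<open>onorm\<close> of
  its linear map.
\<close>

definition ellipsoid :: "real^'d^'d \<Rightarrow> real^'d \<Rightarrow> (real^'d) set" where
  "ellipsoid A c = {z. norm (matrix_inv A *v (z - c)) \<le> 1}"

definition separates ::
  "real^'d \<Rightarrow> real \<Rightarrow> ('j \<Rightarrow> real^'d^'d) \<Rightarrow> ('j \<Rightarrow> real^'d)
    \<Rightarrow> ('l \<Rightarrow> real^'d^'d) \<Rightarrow> ('l \<Rightarrow> real^'d) \<Rightarrow> bool" where
  "separates w s A c B d \<longleftrightarrow>
     (\<forall>z \<in> (\<Union>i. ellipsoid (A i) (c i)). w \<bullet> z < s) \<and>
     (\<forall>z \<in> (\<Union>i. ellipsoid (B i) (d i)). w \<bullet> z > s)"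

definition separable ::
  "('j \<Rightarrow> real^'d^'d) \<Rightarrow> ('j \<Rightarrow> real^'d) \<Rightarrow> ('l \<Rightarrow> real^'d^'d) \<Rightarrow> ('l \<Rightarrow> real^'d) \<Rightarrow> bool" where
  "separable A c B d \<longleftrightarrow> (\<exists>w s. separates w s A c B d)"

definition normalized ::
  "('j::finite \<Rightarrow> real^'d^'d) \<Rightarrow> ('j \<Rightarrow> real^'d) \<Rightarrow> ('l::finite \<Rightarrow> real^'d^'d) \<Rightarrow> ('l \<Rightarrow> real^'d) \<Rightarrow> bool"
  where
  "normalized A c B d \<longleftrightarrow>
     Max (range (\<lambda>i. norm (c i)) \<union> range (\<lambda>i. onorm ((*v) (A i))) \<union>
          range (\<lambda>i. norm (d i)) \<union> range (\<lambda>i. onorm ((*v) (B i)))) = 1"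

definition esp_delta ::
  "('j \<Rightarrow> real^'d^'d) \<Rightarrow> ('j \<Rightarrow> real^'d) \<Rightarrow> ('l \<Rightarrow> real^'d^'d) \<Rightarrow> ('l \<Rightarrow> real^'d) \<Rightarrow> real" where
  "esp_delta A c B d =
     Inf {\<epsilon>. \<epsilon> \<ge> 0 \<and> (\<exists>c' d'. (\<forall>i. norm (c' i - c i) \<le> \<epsilon>) \<and> (\<forall>i. norm (d' i - d i) \<le> \<epsilon>) \<and>
                               \<not> separable A c' B d')}"

text \<open>
  The vector \<open>x = (\<lambda>\<^sub>1, p\<^sub>1, \<dots>, \<lambda>\<^sub>j, p\<^sub>j, \<mu>\<^sub>1, q\<^sub>1, \<dots>, \<mu>\<^sub>l, q\<^sub>l)\<close> is
  the pair of the vector of all \<open>(\<lambda>\<^sub>i, p\<^sub>i)\<close> and the vector of all \<open>(\<mu>\<^sub>i, q\<^sub>i)\<close>.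
\<close>

type_synonym ('d, 'j, 'l) primal = "((real \<times> (real^'d))^'j) \<times> ((real \<times> (real^'d))^'l)"
type_synonym 'd dual = "real \<times> real \<times> (real^'d)"

definition second_order_cone :: "(real \<times> (real^'d)) set" where
  "second_order_cone = {(\<tau>, p). norm p \<le> \<tau>}"

definition esp_cone :: "('d::finite, 'j::finite, 'l::finite) primal set" where
  "esp_cone = {(x, x'). (\<forall>i. x $ i \<in> second_order_cone) \<and> (\<forall>i. x' $ i \<in> second_order_cone)}"

definition esp_rhs :: "'d::finite dual" where
  "esp_rhs = (1, 1, 0)"

definition esp_map ::
  "('j::finite \<Rightarrow> real^'d^'d) \<Rightarrow> ('j \<Rightarrow> real^'d) \<Rightarrow> ('l::finite \<Rightarrow> real^'d^'d) \<Rightarrow> ('l \<Rightarrow> real^'d)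
    \<Rightarrow> ('d::finite, 'j, 'l) primal \<Rightarrow> 'd dual" where
  "esp_map A c B d = (\<lambda>(x, x').
     (\<Sum>i\<in>UNIV. fst (x $ i),
      \<Sum>i\<in>UNIV. fst (x' $ i),
      (\<Sum>i\<in>UNIV. fst (x $ i) *\<^sub>R c i + A i *v snd (x $ i)) -
      (\<Sum>i\<in>UNIV. fst (x' $ i) *\<^sub>R d i - B i *v snd (x' $ i))))"

text \<open>
  PDHG and FISTA for a linear map \<open>F\<close> between Euclidean spaces, a closed convex set \<open>K\<close> and
  a right-hand side \<open>b\<close>; \<^const>\<open>adjoint\<close> and \<^const>\<open>closest_point\<close> are the transpose
  and the projection.
\<close>

definition pdhg_step ::
  "('a::euclidean_space \<Rightarrow> 'b::euclidean_space) \<Rightarrow> 'b \<Rightarrow> 'a set \<Rightarrow> real \<Rightarrow> 'a \<times> 'b \<Rightarrow> 'a \<times> 'b" where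
  "pdhg_step F b K \<sigma> = (\<lambda>(x, y).
     let x' = closest_point K (x - \<sigma> *\<^sub>R adjoint F y)
     in (x', y + F (2 *\<^sub>R x' - x) - b))"

definition pdhg_M ::
  "('a::euclidean_space \<Rightarrow> 'b::euclidean_space) \<Rightarrow> real \<Rightarrow> 'a \<times> 'b \<Rightarrow> 'a \<times> 'b" where
  "pdhg_M F \<sigma> = (\<lambda>(x, y). ((1 / \<sigma>) *\<^sub>R x - adjoint F y, - F x + y))"

definition pdhg_norm ::
  "('a::euclidean_space \<Rightarrow> 'b::euclidean_space) \<Rightarrow> real \<Rightarrow> 'a \<times> 'b \<Rightarrow> real" where
  "pdhg_norm F \<sigma> v = sqrt (v \<bullet> pdhg_M F \<sigma> v)"

text \<open>
  For \<open>0 < \<sigma> < 1 / \<parallel>F\<parallel>\<^sup>2\<close> there is exactly one such \<open>v\<close>: \<^const>\<open>pdhg_norm\<close> is then a Hilbert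
  norm and the closure of the range is convex.
\<close>

definition infimal_displacement ::
  "('a::euclidean_space \<Rightarrow> 'b::euclidean_space) \<Rightarrow> 'b \<Rightarrow> 'a set \<Rightarrow> real \<Rightarrow> 'a \<times> 'b \<Rightarrow> bool" where
  "infimal_displacement F b K \<sigma> v \<longleftrightarrow>
     (let R = closure (range (\<lambda>z. z - pdhg_step F b K \<sigma> z))
      in v \<in> R \<and> (\<forall>u\<in>R. pdhg_norm F \<sigma> v \<le> pdhg_norm F \<sigma> u))"

text \<open>The state is \<open>(x\<^sub>k, y\<^sub>k, t\<^sub>k)\<close>.\<close>

primrec fista_state ::
  "('a::euclidean_space \<Rightarrow> 'b::euclidean_space) \<Rightarrow> 'b \<Rightarrow> 'a set \<Rightarrow> 'a \<Rightarrow> nat \<Rightarrow> 'a \<times> 'a \<times> real" where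
  "fista_state F b K x\<^sub>0 0 = (x\<^sub>0, x\<^sub>0, 1)"
| "fista_state F b K x\<^sub>0 (Suc k) =
     (let (x, y, t) = fista_state F b K x\<^sub>0 k;
          x' = closest_point K (y + (1 / (onorm F)\<^sup>2) *\<^sub>R adjoint F (b - F y));
          t' = (1 + sqrt (1 + 4 * t\<^sup>2)) / 2
      in (x', x' + ((t - 1) / t') *\<^sub>R (x' - x), t'))"

definition fista ::
  "('a::euclidean_space \<Rightarrow> 'b::euclidean_space) \<Rightarrow> 'b \<Rightarrow> 'a set \<Rightarrow> 'a \<Rightarrow> nat \<Rightarrow> 'a" where
  "fista F b K x\<^sub>0 k = fst (fista_state F b K x\<^sub>0 k)"

end

theory Submission
  imports Defs
begin

text \<open>
  Write \<open>F\<close> for the linear map of the conic system, \<open>K\<close> for the product of second-order cones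
  and \<open>b = (1, 1, 0)\<close>. The proof compares the FISTA residual \<open>b - F x\<^sub>k\<close> with the residual
  of least norm on \<open>K\<close>, which separates the ellipsoids with a margin controlled by \<open>\<delta>\<close>.

  The vector \<open>v\<^sub>D = b - F xbar\<close> has least norm among the residuals of points of \<open>K\<close>
  (\<open>infimal_displacement_minimizes_residual\<close>): every \<open>(0, b - F x)\<close> with \<open>x \<in> K\<close> is a
  displacement of PDHG, while the squared \<open>M\<close>-norm of any displacement is at least the squared norm
  of such a residual plus a positive multiple of the squared norm of the primal part.

  Optimality of \<open>v\<^sub>D = (s, t, w)\<close> on a cone says that it has nonpositive inner product with
  \<open>F K\<close>. Read on the single blocks, this is \<open>w \<bullet> z \<le> -s\<close> on the first family
  and \<open>w \<bullet> z \<ge> t\<close> on the second one, and complementarity gives \<open>s + t = \<parallel>v\<^sub>D\<parallel>\<^sup>2\<close>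
  (\<open>minimal_residual_separation\<close>). So the midpoint threshold \<open>(t - s) / 2\<close> leaves a margin
  of \<open>\<parallel>v\<^sub>D\<parallel>\<^sup>2 / 2\<close> on both sides. As all the ellipsoids lie in the ball of radius 2, the
  margin survives any change of \<open>(s, t, w)\<close> of norm less than
  \<open>\<parallel>v\<^sub>D\<parallel>\<^sup>2 / (3 \<surd>2)\<close> (\<open>separates_if_near_margin\<close>).

  To bring in \<open>\<delta>\<close>, normalize the blocks of \<open>xbar\<close>: they give a point of the convex hull of each
  family, and the two points are at distance at most \<open>3 \<parallel>v\<^sub>D\<parallel>\<close>. Moving the two families
  towards each other by half of this distance makes the hulls meet, hence
  \<open>\<delta> \<le> 3/2 \<parallel>v\<^sub>D\<parallel>\<close> (\<open>esp_delta_le_residual\<close>). Separable ellipsoids have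
  \<open>\<delta> > 0\<close> by compactness, so \<open>v\<^sub>D\<close> is nonzero.

  Finally FISTA decreases the objective at rate \<open>1 / k\<^sup>2\<close>, and for least squares a gap in the
  objective bounds the squared distance between residuals, so that
  \<open>\<parallel>F x\<^sub>k - F xbar\<parallel> \<le> 2 \<parallel>F\<parallel> \<parallel>x\<^sub>0 - xbar\<parallel> / (k + 1)\<close> (\<open>fista_residual_rate\<close>).
  For the stated \<open>k\<close> this is at most \<open>\<delta>\<^sup>2 / (27 \<surd>2) \<le> \<parallel>v\<^sub>D\<parallel>\<^sup>2 / (12 \<surd>2)\<close>, a quarter
  of the change that the margin tolerates.
\<close>

section \<open>Convergence of FISTA for constrained least squares\<close>

text \<open>
  The basic inequality of accelerated gradient methods, for the objective \<open>\<parallel>b - F x\<parallel>\<^sup>2\<close> (twice the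
  least-squares objective). It adds up three facts: the objective lies above its linearization at
  \<open>y\<close>, below that linearization plus a quadratic with factor \<open>\<parallel>F\<parallel>\<^sup>2\<close>, and \<open>p\<close> satisfies the
  variational inequality of the projection.
\<close>
lemma projected_gradient_step:
  fixes F :: "'a::euclidean_space \<Rightarrow> 'b::euclidean_space" and b :: 'b and y :: 'a
  assumes F: "linear F" and K: "convex K" "closed K" and x: "x \<in> K" and L: "0 < onorm F"
  defines "p \<equiv> closest_point K (y + (1 / (onorm F)\<^sup>2) *\<^sub>R adjoint F (b - F y))"
  shows "(onorm F)\<^sup>2 * ((norm (p - y))\<^sup>2 + 2 * ((y - x) \<bullet> (p - y)))
           \<le> (norm (b - F x))\<^sup>2 - (norm (b - F p))\<^sup>2"
proof -
  define L where "L = (onorm F)\<^sup>2"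
  define r where "r = b - F y"
  have L0: "L > 0" using L by (simp add: L_def)
  have *: "F u \<bullet> r = u \<bullet> adjoint F r" for u
    using adjoint_works[OF F, of u r] by simp
  have "(y + (1/L) *\<^sub>R adjoint F r - p) \<bullet> (x - p) \<le> 0"
    unfolding p_def L_def r_def by (rule closest_point_dot[OF K x])
  then have "L * ((y + (1/L) *\<^sub>R adjoint F r - p) \<bullet> (x - p)) \<le> 0"
    using L0 by (simp add: mult_le_0_iff)
  then have proj: "L * ((y - p) \<bullet> (x - p)) + F (x - p) \<bullet> r \<le> 0"
    using L0 *[of "x - p"] by (simp add: inner_diff inner_add inner_commute algebra_simps)
  have "norm (F (p - y)) \<le> onorm F * norm (p - y)"
    using onorm[OF linear_conv_bounded_linear[THEN iffD1, OF F]] by simp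
  then have "(norm (F (p - y)))\<^sup>2 \<le> (onorm F * norm (p - y))\<^sup>2"
    by (simp add: power_mono)
  then have Lip: "(norm (F (p - y)))\<^sup>2 \<le> L * (norm (p - y))\<^sup>2"
    by (simp add: L_def power_mult_distrib)
  have ex: "(norm (b - F u))\<^sup>2 = (norm r)\<^sup>2 - 2 * (F (u - y) \<bullet> r) + (norm (F (u - y)))\<^sup>2" for u
    unfolding r_def power2_norm_eq_inner linear_diff[OF F]
    by (simp add: inner_diff inner_commute algebra_simps)
  have FF: "F (x - y) \<bullet> r - F (p - y) \<bullet> r = F (x - p) \<bullet> r"
    by (simp add: linear_diff[OF F] inner_diff)
  have "(norm (b - F x))\<^sup>2 - (norm (b - F p))\<^sup>2
      \<ge> - 2 * (F (x - p) \<bullet> r) - L * (norm (p - y))\<^sup>2"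
    using ex[of x] ex[of p] FF Lip zero_le_power2[of "norm (F (x - y))"] by linarith
  moreover have "- 2 * (F (x - p) \<bullet> r) \<ge> 2 * L * ((y - p) \<bullet> (x - p))" using proj by simp
  moreover have "2 * L * ((y - p) \<bullet> (x - p)) - L * (norm (p - y))\<^sup>2
      = L * ((norm (p - y))\<^sup>2 + 2 * ((y - x) \<bullet> (p - y)))"
    unfolding power2_norm_eq_inner by (simp add: inner_diff inner_commute algebra_simps)
  ultimately show ?thesis by (simp add: L_def)
qed

text \<open>
  The Lyapunov function of Beck and Teboulle, multiplied by \<open>\<parallel>F\<parallel>\<^sup>2\<close>. The momentum scalars are chosen
  such that the next weight \<open>t\<^sup>2 - t\<close> equals the square of the current scalar; this makes the
  step inequality, taken with weight \<open>t - 1\<close> at the previous iterate and with weight 1 at the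
  minimizer, a complete square. At \<open>k = 0\<close> the weight \<open>t\<^sup>2 - t\<close> vanishes, so the bound starts from
  the distance of \<open>x\<^sub>0\<close> to \<open>xs\<close> even if \<open>x\<^sub>0\<close> lies outside \<open>K\<close>.
\<close>
lemma fista_potential:
  fixes F :: "'a::euclidean_space \<Rightarrow> 'b::euclidean_space" and b :: 'b
  assumes F: "linear F" and K: "convex K" "closed K" and xs: "xs \<in> K" and L: "0 < onorm F"
  defines "E \<equiv> \<lambda>x. (norm (b - F x))\<^sup>2 - (norm (b - F xs))\<^sup>2"
  assumes st: "fista_state F b K x\<^sub>0 k = (x, y, t)"
  shows "1 + real k / 2 \<le> t \<and>
         (k \<noteq> 0 \<longrightarrow> x \<in> K \<and> (real k + 1)\<^sup>2 / 4 \<le> t\<^sup>2 - t) \<and>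
         (t\<^sup>2 - t) * E x + (onorm F)\<^sup>2 * (norm (t *\<^sub>R y - (t - 1) *\<^sub>R x - xs))\<^sup>2
           \<le> (onorm F)\<^sup>2 * (norm (x\<^sub>0 - xs))\<^sup>2"
  using st
proof (induction k arbitrary: x y t)
  case 0
  then show ?case by auto
next
  case (Suc k)
  obtain x1 y1 t1 where s1: "fista_state F b K x\<^sub>0 k = (x1, y1, t1)" by (metis prod_cases3)
  define L where "L = (onorm F)\<^sup>2"
  have L0: "L > 0" using L by (simp add: L_def)
  note IH = Suc.IH[OF s1, folded L_def]
  have xeq: "x = closest_point K (y1 + (1 / (onorm F)\<^sup>2) *\<^sub>R adjoint F (b - F y1))"
    and teq: "t = (1 + sqrt (1 + 4 * t1\<^sup>2)) / 2" and yeq: "y = x + ((t1 - 1) / t) *\<^sub>R (x - x1)"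
    using Suc.prems unfolding fista_state.simps s1 Let_def prod.case prod.inject by metis+
  have t1: "1 + real k / 2 \<le> t1" using IH by simp
  then have t11: "t1 \<ge> 1" by simp
  have tt: "t\<^sup>2 - t = t1\<^sup>2"
    unfolding teq power2_eq_square by (simp add: field_simps)
  have "2 * t1 \<le> sqrt (1 + 4 * t1\<^sup>2)"
    by (rule real_le_rsqrt) (simp add: power2_eq_square)
  then have tge: "t \<ge> 1 / 2 + t1" unfolding teq by simp
  then have t: "1 + real (Suc k) / 2 \<le> t" using t1 by (simp add: field_simps)
  have xK: "x \<in> K" unfolding xeq using K xs by (intro closest_point_in_set) auto
  have "((real k + 2) / 2)\<^sup>2 \<le> t1\<^sup>2" using t1 by (intro power_mono) auto
  then have quad: "(real (Suc k) + 1)\<^sup>2 / 4 \<le> t\<^sup>2 - t"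
    by (simp add: tt power_divide add.commute)
  have step: "L * ((norm (x - y1))\<^sup>2 + 2 * ((y1 - u) \<bullet> (x - y1))) \<le> E u - E x" if "u \<in> K" for u
    using projected_gradient_step[OF F K that L, of y1 b] by (simp add: E_def L_def xeq)
  \<comment> \<open>The step inequality is not available at \<open>x\<^sub>0\<close>, which may lie outside \<open>K\<close>; but
    \<open>t = 1\<close> there, so the weight is zero.\<close>
  have s_prev: "(t1 - 1) * (L * ((norm (x - y1))\<^sup>2 + 2 * ((y1 - x1) \<bullet> (x - y1))))
      \<le> (t1 - 1) * (E x1 - E x)"
  proof (cases "k = 0")
    case True
    then show ?thesis using s1 by auto
  next
    case False
    then show ?thesis using IH t11 step[of x1] by (intro mult_left_mono) auto
  qed
  have s_opt: "L * ((norm (x - y1))\<^sup>2 + 2 * ((y1 - xs) \<bullet> (x - y1))) \<le> - E x"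
    using step[OF xs] by (simp add: E_def)
  have lin: "(t1 - 1) * ((y1 - x1) \<bullet> (x - y1)) + (y1 - xs) \<bullet> (x - y1)
      = (t1 *\<^sub>R y1 - (t1 - 1) *\<^sub>R x1 - xs) \<bullet> (x - y1)"
    by (simp add: inner_diff_left algebra_simps)
  define a where "a = t1 *\<^sub>R y1 - (t1 - 1) *\<^sub>R x1 - xs"
  have "L * (t1 * (norm (x - y1))\<^sup>2 + 2 * (a \<bullet> (x - y1))) \<le> (t1 - 1) * E x1 - t1 * E x"
    using add_mono[OF s_prev s_opt] unfolding a_def lin[symmetric] by (simp add: algebra_simps)
  then have "t1 * (L * (t1 * (norm (x - y1))\<^sup>2 + 2 * (a \<bullet> (x - y1))))
      \<le> t1 * ((t1 - 1) * E x1 - t1 * E x)"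
    using t11 by (intro mult_left_mono) auto
  moreover have sq: "t1 * (L * (t1 * (norm (x - y1))\<^sup>2 + 2 * (a \<bullet> (x - y1))))
      = L * ((norm (a + t1 *\<^sub>R (x - y1)))\<^sup>2 - (norm a)\<^sup>2)"
    unfolding power2_norm_eq_inner
    by (simp add: inner_add inner_commute algebra_simps)
  moreover have fin: "a + t1 *\<^sub>R (x - y1) = t *\<^sub>R y - (t - 1) *\<^sub>R x - xs"
  proof -
    have "t \<noteq> 0" using tge t11 by auto
    then have "t *\<^sub>R y = t *\<^sub>R x + (t1 - 1) *\<^sub>R (x - x1)"
      by (simp add: yeq scaleR_add_right)
    then show ?thesis by (simp add: a_def algebra_simps)
  qed
  ultimately have "t1\<^sup>2 * E x + L * (norm (t *\<^sub>R y - (t - 1) *\<^sub>R x - xs))\<^sup>2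
      \<le> (t1\<^sup>2 - t1) * E x1 + L * (norm a)\<^sup>2"
    unfolding sq fin by (simp add: algebra_simps power2_eq_square)
  also have "\<dots> \<le> L * (norm (x\<^sub>0 - xs))\<^sup>2" using IH by (simp add: a_def)
  finally show ?case using t quad xK by (simp add: tt L_def)
qed

text \<open>
  If the inner product were positive, moving from \<open>F xs\<close> a little towards \<open>F x\<close> would come closer to
  \<open>b\<close>. This argument also covers the case that the image of \<open>K\<close> is not closed.
\<close>
lemma least_squares_variational_inequality:
  fixes F :: "'a::euclidean_space \<Rightarrow> 'b::euclidean_space"
  assumes F: "linear F" and K: "convex K" and xs: "xs \<in> K" and x: "x \<in> K"
    and min: "\<forall>u\<in>K. norm (b - F xs) \<le> norm (b - F u)"
  shows "(b - F xs) \<bullet> (F x - F xs) \<le> 0"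
proof (rule ccontr)
  assume "\<not> ?thesis"
  then obtain u where u: "0 < u" "u \<le> 1" "dist (F xs + u *\<^sub>R (F x - F xs)) b < dist (F xs) b"
    using closer_point_lemma[of b "F xs" "F x"] by auto
  have "F xs + u *\<^sub>R (F x - F xs) = F ((1 - u) *\<^sub>R xs + u *\<^sub>R x)"
    by (simp add: linear_add[OF F] linear_diff[OF F] linear_scale[OF F] scaleR_diff_left scaleR_diff_right)
  moreover have "(1 - u) *\<^sub>R xs + u *\<^sub>R x \<in> K"
    using convexD_alt[OF K xs x] u by simp
  ultimately show False
    using min u(3) by (metis dist_commute dist_norm not_le)
qed

text \<open>
  The squared residual distance is at most the gap of the squared norms, since the cross term has a
  sign by the variational inequality; the potential bounds the gap. For \<open>k = 0\<close> the claim is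
  the operator norm bound, whether or not \<open>x\<^sub>0\<close> lies in \<open>K\<close>.
\<close>
lemma fista_residual_rate:
  fixes F :: "'a::euclidean_space \<Rightarrow> 'b::euclidean_space"
  assumes F: "linear F" and K: "convex K" "closed K" and xs: "xs \<in> K" and L: "0 < onorm F"
    and min: "\<forall>u\<in>K. norm (b - F xs) \<le> norm (b - F u)"
  shows "norm (F (fista F b K x\<^sub>0 k) - F xs) \<le> 2 * onorm F * norm (x\<^sub>0 - xs) / (real k + 1)"
proof (cases "k = 0")
  case True
  have "norm (F (x\<^sub>0 - xs)) \<le> onorm F * norm (x\<^sub>0 - xs)"
    using onorm[OF linear_conv_bounded_linear[THEN iffD1, OF F]] by simp
  moreover have "0 \<le> onorm F * norm (x\<^sub>0 - xs)" using L by simp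
  ultimately show ?thesis using True by (simp add: fista_def linear_diff[OF F])
next
  case False
  obtain x y t where s: "fista_state F b K x\<^sub>0 k = (x, y, t)" by (metis prod_cases3)
  define E where "E = (norm (b - F x))\<^sup>2 - (norm (b - F xs))\<^sup>2"
  note P = fista_potential[OF F K xs L s, folded E_def]
  have xK: "x \<in> K" using P False by simp
  have fx: "fista F b K x\<^sub>0 k = x" by (simp add: fista_def s)
  have "E = (norm (F x - F xs))\<^sup>2 - 2 * ((b - F xs) \<bullet> (F x - F xs))"
    unfolding E_def power2_norm_eq_inner by (simp add: inner_diff inner_commute algebra_simps)
  then have E: "(norm (F x - F xs))\<^sup>2 \<le> E"
    using least_squares_variational_inequality[OF F K(1) xs xK min] by simp
  have "0 \<le> (real k + 1)\<^sup>2 / 4" by simp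
  then have "0 \<le> t\<^sup>2 - t" using P False by linarith
  then have "(real k + 1)\<^sup>2 / 4 * (norm (F x - F xs))\<^sup>2 \<le> (t\<^sup>2 - t) * E"
    using P False E by (intro mult_mono) auto
  also have "\<dots> \<le> (onorm F)\<^sup>2 * (norm (x\<^sub>0 - xs))\<^sup>2"
    using P zero_le_power2[of "onorm F * norm (t *\<^sub>R y - (t - 1) *\<^sub>R x - xs)"]
    unfolding power_mult_distrib by linarith
  finally have "((real k + 1) / 2 * norm (F x - F xs))\<^sup>2 \<le> (onorm F * norm (x\<^sub>0 - xs))\<^sup>2"
    by (simp add: power_mult_distrib power_divide)
  then have "(real k + 1) / 2 * norm (F x - F xs) \<le> onorm F * norm (x\<^sub>0 - xs)"
    by (rule power2_le_imp_le) (use L in simp)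
  then show ?thesis by (simp add: fx field_simps)
qed

section \<open>The infimal displacement vector\<close>

text \<open>
  Completing the square in the dual part: \<open>w - F u\<close> is the combination which, along a PDHG step,
  becomes the residual \<open>b - F x\<close> at the new primal point.
\<close>
lemma pdhg_norm_square:
  fixes F :: "'a::euclidean_space \<Rightarrow> 'b::euclidean_space"
  assumes F: "linear F"
  shows "(u, w) \<bullet> pdhg_M F \<sigma> (u, w) = (norm (w - F u))\<^sup>2 + ((norm u)\<^sup>2 / \<sigma> - (norm (F u))\<^sup>2)"
  using adjoint_works[OF F, of u w]
  by (simp add: pdhg_M_def inner_Pair power2_norm_eq_inner inner_diff inner_add inner_commute
      algebra_simps)

text \<open>
  Let \<open>\<rho>\<close> be the infimum of the residual norms on \<open>K\<close>. Every displacement \<open>(u, w)\<close> satisfies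
  \<open>\<parallel>w - F u\<parallel> \<ge> \<rho>\<close>, a closed condition, so its squared \<open>M\<close>-norm is at least
  \<open>\<rho>\<^sup>2 + \<kappa> \<parallel>u\<parallel>\<^sup>2\<close> with \<open>\<kappa> > 0\<close>. A PDHG step from \<open>(x, 0)\<close> with \<open>x \<in> K\<close>
  has the displacement \<open>(0, b - F x)\<close>, so the least squared \<open>M\<close>-norm is at most \<open>\<rho>\<^sup>2\<close>. Hence the
  primal part of the infimal displacement is zero and its dual part has norm \<open>\<rho>\<close>.
\<close>
lemma infimal_displacement_minimizes_residual:
  fixes F :: "'a::euclidean_space \<Rightarrow> 'b::euclidean_space"
  assumes F: "linear F" and K: "convex K" "closed K" "K \<noteq> {}"
    and \<sigma>: "0 < \<sigma>" "\<sigma> < 1 / (onorm F)\<^sup>2"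
    and v: "infimal_displacement F b K \<sigma> (v\<^sub>R, v\<^sub>D)" and x: "x \<in> K"
  shows "norm v\<^sub>D \<le> norm (b - F x)"
proof -
  define \<kappa> where "\<kappa> = 1 / \<sigma> - (onorm F)\<^sup>2"
  define \<rho> where "\<rho> = (INF u\<in>K. norm (b - F u))"
  define Q where "Q = (\<lambda>z. z \<bullet> pdhg_M F \<sigma> z)"
  define R where "R = range (\<lambda>z. z - pdhg_step F b K \<sigma> z)"
  have bl: "bounded_linear F" using F by (simp add: linear_conv_bounded_linear)
  have cF: "continuous_on S (\<lambda>z. F (fst z))" for S :: "('a \<times> 'b) set"
    by (intro bounded_linear.continuous_on[OF bl] continuous_on_fst continuous_on_id)
  have L0: "0 < (onorm F)\<^sup>2"
    using \<sigma> by (cases "onorm F = 0") auto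
  have \<kappa>: "\<kappa> > 0" using \<sigma> L0 by (simp add: \<kappa>_def field_simps)
  have \<rho>_le: "\<rho> \<le> norm (b - F u)" if "u \<in> K" for u
    unfolding \<rho>_def using that by (intro cINF_lower) (auto intro!: bdd_belowI[of _ 0])
  have \<rho>0: "0 \<le> \<rho>" unfolding \<rho>_def using K(3) by (intro cINF_greatest) auto
  have Q: "Q (u, w) = (norm (w - F u))\<^sup>2 + ((norm u)\<^sup>2 / \<sigma> - (norm (F u))\<^sup>2)" for u w
    by (simp add: Q_def pdhg_norm_square[OF F])
  have Qge: "(norm (w - F u))\<^sup>2 + \<kappa> * (norm u)\<^sup>2 \<le> Q (u, w)" for u w
  proof -
    have "norm (F u) \<le> onorm F * norm u" by (rule onorm[OF bl])
    then have "(norm (F u))\<^sup>2 \<le> (onorm F * norm u)\<^sup>2" by (simp add: power_mono)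
    then show ?thesis by (simp add: Q \<kappa>_def power_mult_distrib algebra_simps)
  qed
  have in_R: "(0, b - F u) \<in> R" if "u \<in> K" for u
  proof -
    have "(u, 0) - pdhg_step F b K \<sigma> (u, 0) = (0, b - F u)"
      using that by (simp add: pdhg_step_def Let_def linear_0[OF adjoint_linear[OF F]]
          closest_point_self scaleR_2)
    then show ?thesis unfolding R_def by (intro range_eqI[where x = "(u, 0)"]) simp
  qed
  have "R \<subseteq> {z. \<rho> \<le> norm (snd z - F (fst z))}"
  proof
    fix z assume "z \<in> R"
    then obtain x1 y1 where z: "z = (x1, y1) - pdhg_step F b K \<sigma> (x1, y1)"
      unfolding R_def by auto
    define x2 where "x2 = closest_point K (x1 - \<sigma> *\<^sub>R adjoint F y1)"
    have "x2 \<in> K" unfolding x2_def using K by (intro closest_point_in_set) auto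
    moreover have "snd z - F (fst z) = b - F x2"
      unfolding z pdhg_step_def
      by (simp add: Let_def x2_def[symmetric] linear_diff[OF F] linear_add[OF F] scaleR_2)
    ultimately show "z \<in> {z. \<rho> \<le> norm (snd z - F (fst z))}" using \<rho>_le by simp
  qed
  moreover have "closed {z :: 'a \<times> 'b. \<rho> \<le> norm (snd z - F (fst z))}"
    by (intro closed_Collect_le continuous_intros cF)
  ultimately have clR: "closure R \<subseteq> {z. \<rho> \<le> norm (snd z - F (fst z))}"
    by (rule closure_minimal)
  have vR: "(v\<^sub>R, v\<^sub>D) \<in> closure R"
    and vmin: "\<And>u. u \<in> closure R \<Longrightarrow> sqrt (Q (v\<^sub>R, v\<^sub>D)) \<le> sqrt (Q u)"
    using v by (auto simp: infimal_displacement_def Let_def R_def Q_def pdhg_norm_def)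
  have Qle: "Q (v\<^sub>R, v\<^sub>D) \<le> (norm (b - F u))\<^sup>2" if "u \<in> K" for u
  proof -
    have "sqrt (Q (v\<^sub>R, v\<^sub>D)) \<le> sqrt (Q (0, b - F u))"
      using in_R[OF that] closure_subset[of R] by (intro vmin) blast
    also have "\<dots> = norm (b - F u)" by (simp add: Q linear_0[OF F])
    finally show ?thesis by (rule sqrt_le_D)
  qed
  have "sqrt (Q (v\<^sub>R, v\<^sub>D)) \<le> \<rho>"
    unfolding \<rho>_def using Qle K(3) by (intro cINF_greatest real_le_lsqrt) (auto simp: real_le_lsqrt)
  moreover have Qnn: "0 \<le> Q (v\<^sub>R, v\<^sub>D)"
    using \<kappa> by (intro order_trans[OF _ Qge]) auto
  ultimately have "Q (v\<^sub>R, v\<^sub>D) \<le> \<rho>\<^sup>2" using \<rho>0 by (simp add: sqrt_le_D)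
  moreover have "\<rho>\<^sup>2 \<le> (norm (v\<^sub>D - F v\<^sub>R))\<^sup>2"
    using clR vR \<rho>0 by (intro power_mono) auto
  ultimately have "\<kappa> * (norm v\<^sub>R)\<^sup>2 \<le> 0" using Qge[of v\<^sub>D v\<^sub>R] by linarith
  then have "v\<^sub>R = 0" using \<kappa> by (simp add: mult_le_0_iff)
  then have "(norm v\<^sub>D)\<^sup>2 \<le> (norm (b - F x))\<^sup>2"
    using Qle[OF x] by (simp add: Q linear_0[OF F])
  then show ?thesis by (rule power2_le_imp_le) simp
qed

section \<open>Ellipsoids and the separation margin\<close>

lemma matrix_inv_inverse:
  assumes "invertible A"
  shows "A ** matrix_inv A = mat 1" and "matrix_inv A ** A = mat 1"
  using someI_ex[OF assms[unfolded invertible_def]] unfolding matrix_inv_def by simp_all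

lemma mem_ellipsoid_iff:
  assumes "invertible A"
  shows "z \<in> ellipsoid A c \<longleftrightarrow> (\<exists>p. norm p \<le> 1 \<and> z = c + A *v p)"
proof
  assume "z \<in> ellipsoid A c"
  moreover have "z = c + A *v (matrix_inv A *v (z - c))"
    by (simp add: matrix_vector_mul_assoc matrix_inv_inverse[OF assms])
  ultimately show "\<exists>p. norm p \<le> 1 \<and> z = c + A *v p"
    unfolding ellipsoid_def by blast
next
  assume "\<exists>p. norm p \<le> 1 \<and> z = c + A *v p"
  then show "z \<in> ellipsoid A c"
    by (auto simp: ellipsoid_def matrix_vector_mul_assoc matrix_inv_inverse[OF assms])
qed

lemma ellipsoid_eq_image:
  assumes "invertible A"
  shows "ellipsoid A c = (\<lambda>p. c + A *v p) ` cball 0 1"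
  using mem_ellipsoid_iff[OF assms] by auto

lemma compact_ellipsoid:
  assumes "invertible A"
  shows "compact (ellipsoid A c)"
  unfolding ellipsoid_eq_image[OF assms]
  by (intro compact_continuous_image continuous_intros compact_cball
      linear_continuous_on matrix_vector_mul_bounded_linear)

lemma center_in_ellipsoid: "c \<in> ellipsoid A c"
  by (simp add: ellipsoid_def)

lemma ellipsoid_translate: "z \<in> ellipsoid A c \<Longrightarrow> z + h \<in> ellipsoid A (c + h)"
  by (simp add: ellipsoid_def)

lemma ellipsoid_subset_cball:
  assumes "invertible A" and "norm c \<le> 1" and "onorm ((*v) A) \<le> 1"
  shows "ellipsoid A c \<subseteq> cball 0 2"
proof
  fix z assume "z \<in> ellipsoid A c"
  then obtain p where p: "norm p \<le> 1" "z = c + A *v p"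
    using mem_ellipsoid_iff[OF assms(1)] by blast
  have "norm (A *v p) \<le> onorm ((*v) A) * norm p"
    by (rule onorm[OF matrix_vector_mul_bounded_linear])
  also have "\<dots> \<le> 1 * 1"
    using assms(3) p(1) by (intro mult_mono) auto
  finally have "norm z \<le> 2"
    unfolding p(2) using assms(2) norm_triangle_ineq[of c "A *v p"] by linarith
  then show "z \<in> cball 0 2" by simp
qed

text \<open>
  Homogenization: \<open>r i *\<^sub>R c i + A i *v p i\<close> is \<open>r i\<close> times a point of the \<open>i\<close>-th ellipsoid, so that
  the sum is \<open>\<Sum>i. r i\<close> times a convex combination. If all \<open>r i\<close> vanish, any point of the hull will do;
  allowing this spares a case distinction later on.
\<close>
lemma conic_combination_in_hull:
  fixes A :: "'i::finite \<Rightarrow> real^'d::finite^'d" and r :: "'i \<Rightarrow> real"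
  assumes A: "\<And>i. invertible (A i)" and p: "\<And>i. norm (p i) \<le> r i"
  obtains P where "P \<in> convex hull (\<Union>i. ellipsoid (A i) (c i))"
    and "(\<Sum>i\<in>UNIV. r i *\<^sub>R c i + A i *v p i) = (\<Sum>i\<in>UNIV. r i) *\<^sub>R P"
proof -
  define \<rho> where "\<rho> = (\<Sum>i\<in>UNIV. r i)"
  have r: "0 \<le> r i" for i using order_trans[OF norm_ge_zero p] .
  show thesis
  proof (cases "\<rho> = 0")
    case True
    then have "r i = 0" for i
      using r by (simp add: \<rho>_def sum_nonneg_eq_0_iff)
    moreover from this have "p i = 0" for i using p[of i] by simp
    moreover have "c undefined \<in> convex hull (\<Union>i. ellipsoid (A i) (c i))"
      by (rule hull_inc) (blast intro: center_in_ellipsoid)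
    ultimately show ?thesis by (intro that) auto
  next
    case False
    define y where "y = (\<lambda>i. c i + A i *v ((1 / r i) *\<^sub>R p i))"
    have y: "y i \<in> convex hull (\<Union>i. ellipsoid (A i) (c i))" for i
    proof -
      have "norm ((1 / r i) *\<^sub>R p i) \<le> 1"
        using p[of i] r[of i] by (cases "r i = 0") (auto simp: field_simps)
      then have "y i \<in> ellipsoid (A i) (c i)"
        unfolding mem_ellipsoid_iff[OF A] y_def by blast
      then show ?thesis by (intro hull_inc) blast
    qed
    have "(\<Sum>i\<in>UNIV. (r i / \<rho>) *\<^sub>R y i) \<in> convex hull (\<Union>i. ellipsoid (A i) (c i))"
    proof (rule convex_sum)
      show "(\<Sum>i\<in>UNIV. r i / \<rho>) = 1"
        using False by (simp add: \<rho>_def flip: sum_divide_distrib)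
      show "0 \<le> r i / \<rho>" for i using r by (simp add: \<rho>_def sum_nonneg)
    qed (auto simp: y convex_convex_hull)
    moreover have "r i *\<^sub>R y i = r i *\<^sub>R c i + A i *v p i" for i
      using p[of i] by (cases "r i = 0")
        (auto simp: y_def scaleR_add_right matrix_vector_mult_scaleR)
    then have "(\<Sum>i\<in>UNIV. r i *\<^sub>R c i + A i *v p i) = \<rho> *\<^sub>R (\<Sum>i\<in>UNIV. (r i / \<rho>) *\<^sub>R y i)"
      using False by (simp add: scaleR_sum_right)
    ultimately show ?thesis by (intro that) (auto simp: \<rho>_def)
  qed
qed

text \<open>
  The shifts by \<open>h = (P - Q) / 2\<close> carry \<open>P\<close> and \<open>Q\<close> to their common midpoint, and a hyperplane that
  separates two sets separates their convex hulls.
\<close>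
lemma not_separable_if_hull_points_meet:
  assumes P: "P \<in> convex hull (\<Union>i. ellipsoid (A i) (c i))"
    and Q: "Q \<in> convex hull (\<Union>i. ellipsoid (B i) (d i))"
  shows "\<not> separable A (\<lambda>i. c i - (1/2) *\<^sub>R (P - Q)) B (\<lambda>i. d i + (1/2) *\<^sub>R (P - Q))"
proof
  define h where "h = (1/2) *\<^sub>R (P - Q)"
  assume "separable A (\<lambda>i. c i - (1/2) *\<^sub>R (P - Q)) B (\<lambda>i. d i + (1/2) *\<^sub>R (P - Q))"
  then obtain w s where ws: "separates w s A (\<lambda>i. c i - h) B (\<lambda>i. d i + h)"
    unfolding separable_def h_def by blast
  have "convex hull (\<Union>i. ellipsoid (A i) (c i)) \<subseteq> {z. w \<bullet> z < s + w \<bullet> h}"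
  proof (rule hull_minimal)
    show "(\<Union>i. ellipsoid (A i) (c i)) \<subseteq> {z. w \<bullet> z < s + w \<bullet> h}"
    proof clarsimp
      fix z i assume "z \<in> ellipsoid (A i) (c i)"
      then have "z + - h \<in> ellipsoid (A i) (c i - h)"
        using ellipsoid_translate[of z "A i" "c i" "- h"] by simp
      then have "w \<bullet> (z + - h) < s" using ws unfolding separates_def by blast
      then show "w \<bullet> z < s + w \<bullet> h" by (simp add: inner_diff_right)
    qed
  qed (rule convex_halfspace_lt)
  then have "w \<bullet> P < s + w \<bullet> h" using P by blast
  moreover have "convex hull (\<Union>i. ellipsoid (B i) (d i)) \<subseteq> {z. w \<bullet> z > s - w \<bullet> h}"
  proof (rule hull_minimal)
    show "(\<Union>i. ellipsoid (B i) (d i)) \<subseteq> {z. w \<bullet> z > s - w \<bullet> h}"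
    proof clarsimp
      fix z i assume "z \<in> ellipsoid (B i) (d i)"
      then have "z + h \<in> ellipsoid (B i) (d i + h)"
        by (rule ellipsoid_translate)
      then have "w \<bullet> (z + h) > s" using ws unfolding separates_def by blast
      then show "s - w \<bullet> h < w \<bullet> z" by (simp add: inner_add_right)
    qed
  qed (rule convex_halfspace_gt)
  then have "w \<bullet> Q > s - w \<bullet> h" using Q by blast
  moreover have "2 * (w \<bullet> h) = w \<bullet> P - w \<bullet> Q" by (simp add: h_def inner_diff_right)
  ultimately show False by linarith
qed

lemma esp_delta_le_half_dist:
  assumes "P \<in> convex hull (\<Union>i. ellipsoid (A i) (c i))"
    and "Q \<in> convex hull (\<Union>i. ellipsoid (B i) (d i))"
  shows "esp_delta A c B d \<le> norm (P - Q) / 2"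
  unfolding esp_delta_def
proof (rule cInf_lower)
  show "norm (P - Q) / 2 \<in> {\<epsilon>. \<epsilon> \<ge> 0 \<and> (\<exists>c' d'. (\<forall>i. norm (c' i - c i) \<le> \<epsilon>) \<and>
      (\<forall>i. norm (d' i - d i) \<le> \<epsilon>) \<and> \<not> separable A c' B d')}"
    using not_separable_if_hull_points_meet[OF assms]
    by (auto intro!: exI[of _ "\<lambda>i. c i - (1/2) *\<^sub>R (P - Q)"]
        exI[of _ "\<lambda>i. d i + (1/2) *\<^sub>R (P - Q)"])
qed (auto intro: bdd_belowI[of _ 0])

text \<open>
  A separating hyperplane has a positive gap \<open>g\<close> to both compact unions, and moving a center by
  \<open>\<epsilon>\<close> changes the values of \<open>w\<close> on its ellipsoid by at most \<open>\<parallel>w\<parallel> \<epsilon>\<close>. The infimum is over a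
  nonempty set, so it inherits the resulting lower bound.
\<close>
lemma esp_delta_pos:
  fixes A :: "'j::finite \<Rightarrow> real^'d::finite^'d" and B :: "'l::finite \<Rightarrow> real^'d^'d"
  assumes A: "\<And>i. invertible (A i)" and B: "\<And>i. invertible (B i)" and "separable A c B d"
  shows "0 < esp_delta A c B d"
proof -
  obtain w s where ws: "separates w s A c B d" using assms(3) unfolding separable_def by blast
  define C where "C = (\<Union>i. ellipsoid (A i) (c i))"
  define D where "D = (\<Union>i. ellipsoid (B i) (d i))"
  have "compact C" "compact D"
    unfolding C_def D_def using A B by (auto intro!: compact_UN compact_ellipsoid)
  moreover have ne: "C \<noteq> {}" "D \<noteq> {}"
    unfolding C_def D_def using center_in_ellipsoid by blast+
  moreover have "continuous_on S ((\<bullet>) w)" for S by (intro continuous_intros)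
  ultimately obtain zc zd where zc: "zc \<in> C" "\<And>z. z \<in> C \<Longrightarrow> w \<bullet> z \<le> w \<bullet> zc"
    and zd: "zd \<in> D" "\<And>z. z \<in> D \<Longrightarrow> w \<bullet> zd \<le> w \<bullet> z"
    using continuous_attains_sup[of C "(\<bullet>) w"] continuous_attains_inf[of D "(\<bullet>) w"] by metis
  define g where "g = min (s - w \<bullet> zc) (w \<bullet> zd - s)"
  have g: "g > 0"
    using ws zc(1) zd(1) by (auto simp: g_def separates_def C_def D_def)
  \<comment> \<open>The summand 1 only avoids a division by zero.\<close>
  define \<eta> where "\<eta> = g / (norm w + 1)"
  have \<eta>: "\<eta> > 0" using g by (simp add: \<eta>_def add_nonneg_pos)
  have far: "\<eta> \<le> \<epsilon>"
    if c': "\<And>i. norm (c' i - c i) \<le> \<epsilon>" and d': "\<And>i. norm (d' i - d i) \<le> \<epsilon>"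
      and ns: "\<not> separable A c' B d'" for \<epsilon> c' d'
  proof (rule ccontr)
    assume "\<not> \<eta> \<le> \<epsilon>"
    then have "\<epsilon> * (norm w + 1) < g"
      by (simp add: \<eta>_def not_le pos_less_divide_eq add_nonneg_pos)
    moreover have "0 \<le> \<epsilon>" using order_trans[OF norm_ge_zero c'] .
    ultimately have small: "norm w * \<epsilon> < g" by (simp add: algebra_simps)
    have shift: "\<bar>w \<bullet> h\<bar> < g" if "norm h \<le> \<epsilon>" for h
      using Cauchy_Schwarz_ineq2[of w h] mult_left_mono[OF that norm_ge_zero[of w]] small
      by linarith
    have "separates w s A c' B d'"
      unfolding separates_def
    proof (intro conjI ballI)
      fix z assume "z \<in> (\<Union>i. ellipsoid (A i) (c' i))"
      then obtain i where "z \<in> ellipsoid (A i) (c' i)" by blast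
      then have "z + - (c' i - c i) \<in> ellipsoid (A i) (c i)"
        using ellipsoid_translate[of z "A i" "c' i" "- (c' i - c i)"] by simp
      then have "w \<bullet> (z + - (c' i - c i)) \<le> w \<bullet> zc" by (intro zc) (auto simp: C_def)
      then have "w \<bullet> z \<le> w \<bullet> zc + w \<bullet> (c' i - c i)" by (simp add: inner_diff_right inner_add_right)
      then show "w \<bullet> z < s" using shift[OF c', of i] by (simp add: g_def abs_less_iff)
    next
      fix z assume "z \<in> (\<Union>i. ellipsoid (B i) (d' i))"
      then obtain i where "z \<in> ellipsoid (B i) (d' i)" by blast
      then have "z + - (d' i - d i) \<in> ellipsoid (B i) (d i)"
        using ellipsoid_translate[of z "B i" "d' i" "- (d' i - d i)"] by simp
      then have "w \<bullet> zd \<le> w \<bullet> (z + - (d' i - d i))" by (intro zd) (auto simp: D_def)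
      then have "w \<bullet> zd + w \<bullet> (d' i - d i) \<le> w \<bullet> z" by (simp add: inner_diff_right inner_add_right)
      then show "s < w \<bullet> z" using shift[OF d', of i] by (simp add: g_def abs_less_iff)
    qed
    then show False using ns unfolding separable_def by blast
  qed
  have "\<eta> \<le> esp_delta A c B d"
    unfolding esp_delta_def
  proof (rule cInf_greatest)
    have PQ: "zc \<in> convex hull (\<Union>i. ellipsoid (A i) (c i))"
      "zd \<in> convex hull (\<Union>i. ellipsoid (B i) (d i))"
      using zc(1) zd(1) by (auto simp: C_def D_def intro: hull_inc)
    show "{\<epsilon>. \<epsilon> \<ge> 0 \<and> (\<exists>c' d'. (\<forall>i. norm (c' i - c i) \<le> \<epsilon>) \<and>
      (\<forall>i. norm (d' i - d i) \<le> \<epsilon>) \<and> \<not> separable A c' B d')} \<noteq> {}"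
      using not_separable_if_hull_points_meet[OF PQ]
      by (auto intro!: exI[of _ "norm (zc - zd) / 2"] exI[of _ "\<lambda>i. c i - (1/2) *\<^sub>R (zc - zd)"]
          exI[of _ "\<lambda>i. d i + (1/2) *\<^sub>R (zc - zd)"])
  qed (use far in blast)
  then show ?thesis using \<eta> by linarith
qed

lemma weighted_sum_le_norm:
  "a * norm w + b * s + e * t \<le> sqrt (a\<^sup>2 + b\<^sup>2 + e\<^sup>2) * norm (s, t, w :: 'a::real_inner)"
proof -
  have "(a, b, e) \<bullet> (norm w, s, t) \<le> norm (a, b, e) * norm (norm w, s, t)"
    by (rule norm_cauchy_schwarz)
  then show ?thesis
    by (simp add: inner_Pair norm_Pair add_ac)
qed

text \<open>
  On the ball of radius 2 the value of \<open>w\<close> changes by at most \<open>2 \<parallel>w' - w\<parallel>\<close> and the midpoint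
  threshold by half the difference of the changes of \<open>s\<close> and \<open>t\<close>. The weights \<open>2, 1/2, 1/2\<close> have
  Euclidean norm \<open>3 / \<surd>2\<close>, and the available margin is \<open>(s + t) / 2\<close>.
\<close>
lemma separates_if_near_margin:
  assumes C2: "\<And>i. ellipsoid (A i) (c i) \<subseteq> cball 0 2" and D2: "\<And>i. ellipsoid (B i) (d i) \<subseteq> cball 0 2"
    and C: "\<And>i z. z \<in> ellipsoid (A i) (c i) \<Longrightarrow> w \<bullet> z \<le> - s"
    and D: "\<And>i z. z \<in> ellipsoid (B i) (d i) \<Longrightarrow> t \<le> w \<bullet> z"
    and near: "3 * sqrt 2 * norm ((s', t', w') - (s, t, w)) < s + t"
  shows "separates w' ((- s' + t') / 2) A c B d"
proof -
  define \<omega> where "\<omega> = w' - w"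
  define e where "e = norm (s' - s, t' - t, \<omega>)"
  have e: "3 * sqrt 2 * e < s + t" using near by (simp add: e_def \<omega>_def)
  have sq: "sqrt (9 / 2 :: real) = 3 * sqrt 2 / 2"
    by (rule real_sqrt_unique) (auto simp: power_mult_distrib power_divide)
  have 1: "2 * norm \<omega> + (1/2) * (s' - s) + (- 1/2) * (t' - t) < (s + t) / 2"
    using weighted_sum_le_norm[of 2 \<omega> "1/2" "s' - s" "-1/2" "t' - t"] e
    by (simp add: sq power_divide flip: e_def)
  have 2: "2 * norm \<omega> + (- 1/2) * (s' - s) + (1/2) * (t' - t) < (s + t) / 2"
    using weighted_sum_le_norm[of 2 \<omega> "-1/2" "s' - s" "1/2" "t' - t"] e
    by (simp add: sq power_divide flip: e_def)
  have shift: "\<bar>\<omega> \<bullet> z\<bar> \<le> 2 * norm \<omega>" if "norm z \<le> 2" for z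
    using Cauchy_Schwarz_ineq2[of \<omega> z] mult_left_mono[OF that norm_ge_zero[of \<omega>]] by linarith
  have w': "w' \<bullet> z = w \<bullet> z + \<omega> \<bullet> z" for z by (simp add: \<omega>_def inner_diff_left)
  show ?thesis
    unfolding separates_def
  proof (intro conjI ballI)
    fix z assume "z \<in> (\<Union>i. ellipsoid (A i) (c i))"
    then have "norm z \<le> 2" "w \<bullet> z \<le> - s" using C C2 by fastforce+
    then show "w' \<bullet> z < (- s' + t') / 2" using shift[of z] 1 w'[of z] by argo
  next
    fix z assume "z \<in> (\<Union>i. ellipsoid (B i) (d i))"
    then have "norm z \<le> 2" "t \<le> w \<bullet> z" using D D2 by fastforce+
    then show "(- s' + t') / 2 < w' \<bullet> z" using shift[of z] 2 w'[of z] by argo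
  qed
qed

section \<open>The conic feasibility system\<close>

lemma linear_esp_map: "linear (esp_map A c B d)"
proof (rule linearI)
  show "esp_map A c B d (x + y) = esp_map A c B d x + esp_map A c B d y" for x y
    by (simp add: esp_map_def split_beta sum.distrib sum_subtractf scaleR_add_left
        matrix_vector_right_distrib)
  show "esp_map A c B d (r *\<^sub>R x) = r *\<^sub>R esp_map A c B d x" for r x
    by (simp add: esp_map_def split_beta scaleR_sum_right scaleR_add_right scaleR_diff_right
        sum_distrib_left matrix_vector_mult_scaleR)
qed

lemma esp_cone_alt:
  "esp_cone = {z. (\<forall>i. norm (snd (fst z $ i)) \<le> fst (fst z $ i)) \<and>
                  (\<forall>i. norm (snd (snd z $ i)) \<le> fst (snd z $ i))}"
  by (auto simp: esp_cone_def second_order_cone_def split_beta)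

lemma closed_esp_cone: "closed esp_cone"
  unfolding esp_cone_alt
  by (intro closed_Collect_conj closed_Collect_all closed_Collect_le continuous_intros)

lemma norm_conic_combination_le:
  assumes "norm (snd x) \<le> fst x" and "norm (snd y) \<le> fst y" and "0 \<le> a" and "0 \<le> b"
  shows "norm (a *\<^sub>R snd x + b *\<^sub>R snd y) \<le> a * fst x + b * fst y"
  using assms by (intro norm_triangle_le add_mono) (auto simp: mult_left_mono)

lemma esp_cone_conic_combination:
  assumes "x \<in> esp_cone" and "y \<in> esp_cone" and "0 \<le> a" and "0 \<le> b"
  shows "a *\<^sub>R x + b *\<^sub>R y \<in> esp_cone"
  using assms by (auto simp: esp_cone_alt intro!: norm_conic_combination_le)

lemma convex_esp_cone: "convex esp_cone"
  by (auto simp: convex_def intro!: esp_cone_conic_combination)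

lemma zero_in_esp_cone: "0 \<in> esp_cone"
  by (simp add: esp_cone_alt)

text \<open>
  Testing the operator on a single block with \<open>\<tau> = 1\<close> picks out the points of one ellipsoid.
\<close>
lemma esp_map_axis_fst:
  "esp_map A c B d (axis i (1, p), 0) = (1, 0, c i + A i *v p)"
proof -
  have "(\<Sum>k\<in>UNIV. fst (axis i (1 :: real, p) $ k)) = (\<Sum>k\<in>UNIV. if k = i then 1 else 0)"
    by (rule sum.cong) (auto simp: axis_def)
  moreover have "(\<Sum>k\<in>UNIV. fst (axis i (1, p) $ k) *\<^sub>R c k + A k *v snd (axis i (1, p) $ k))
      = (\<Sum>k\<in>UNIV. if k = i then c i + A i *v p else 0)"
    by (rule sum.cong) (auto simp: axis_def)
  ultimately show ?thesis by (simp add: esp_map_def)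
qed

lemma esp_map_axis_snd:
  "esp_map A c B d (0, axis i (1, q)) = (0, 1, - (d i - B i *v q))"
proof -
  have "(\<Sum>k\<in>UNIV. fst (axis i (1 :: real, q) $ k)) = (\<Sum>k\<in>UNIV. if k = i then 1 else 0)"
    by (rule sum.cong) (auto simp: axis_def)
  moreover have e2: "(\<Sum>k\<in>UNIV. fst (axis i (1, q) $ k) *\<^sub>R d k - B k *v snd (axis i (1, q) $ k))
      = (\<Sum>k\<in>UNIV. if k = i then d i - B i *v q else 0)"
    by (rule sum.cong) (auto simp: axis_def)
  ultimately show ?thesis unfolding esp_map_def prod.case e2 by simp
qed

text \<open>
  The optimality conditions over a cone, from the variational inequality at \<open>0\<close> and \<open>2 *\<^sub>R xs\<close>.
\<close>
lemma minimal_residual_polar: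
  assumes xs: "xs \<in> esp_cone"
    and min: "\<forall>u\<in>esp_cone. norm (b - esp_map A c B d xs) \<le> norm (b - esp_map A c B d u)"
  shows "(b - esp_map A c B d xs) \<bullet> esp_map A c B d xs = 0"
    and "\<And>x. x \<in> esp_cone \<Longrightarrow> (b - esp_map A c B d xs) \<bullet> esp_map A c B d x \<le> 0"
proof -
  let ?F = "esp_map A c B d"
  have VI: "(b - ?F xs) \<bullet> (?F x - ?F xs) \<le> 0" if "x \<in> esp_cone" for x
    by (rule least_squares_variational_inequality[OF linear_esp_map convex_esp_cone xs that min])
  have "2 *\<^sub>R xs \<in> esp_cone"
    using esp_cone_conic_combination[OF xs xs, of 1 1] by (simp add: scaleR_2)
  moreover have "?F (2 *\<^sub>R xs) - ?F xs = ?F xs"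
    by (simp only: linear_scale[OF linear_esp_map]) (simp add: scaleR_2)
  ultimately show "(b - ?F xs) \<bullet> ?F xs = 0"
    using VI[OF zero_in_esp_cone] VI[of "2 *\<^sub>R xs"] by (simp add: linear_0[OF linear_esp_map])
  then show "(b - ?F xs) \<bullet> ?F x \<le> 0" if "x \<in> esp_cone" for x
    using VI[OF that] by (simp add: inner_diff_right)
qed

text \<open>
  The first two claims are the polarity of the residual, tested on single blocks. For the third one,
  \<open>s + t\<close> is the inner product of the residual with \<open>b\<close>, and \<open>b\<close> is the residual plus a vector
  orthogonal to it.
\<close>
lemma minimal_residual_separation:
  assumes A: "\<And>i. invertible (A i)" and B: "\<And>i. invertible (B i)" and xs: "xs \<in> esp_cone"
    and min: "\<forall>u\<in>esp_cone.
      norm (esp_rhs - esp_map A c B d xs) \<le> norm (esp_rhs - esp_map A c B d u)"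
    and v: "esp_rhs - esp_map A c B d xs = (s, t, w)"
  shows "z \<in> ellipsoid (A i) (c i) \<Longrightarrow> w \<bullet> z \<le> - s"
    and "z \<in> ellipsoid (B k) (d k) \<Longrightarrow> t \<le> w \<bullet> z"
    and "s + t = (norm (s, t, w))\<^sup>2"
proof -
  note polar = minimal_residual_polar[OF xs min, unfolded v]
  show "w \<bullet> z \<le> - s" if z: "z \<in> ellipsoid (A i) (c i)"
  proof -
    obtain p where p: "norm p \<le> 1" "z = c i + A i *v p"
      using z unfolding mem_ellipsoid_iff[OF A] by blast
    have "(axis i (1, p), 0) \<in> esp_cone"
      using p(1) by (auto simp: esp_cone_alt axis_def)
    from polar(2)[OF this] show ?thesis
      by (simp add: esp_map_axis_fst p(2) inner_Pair)
  qed
  show "t \<le> w \<bullet> z" if z: "z \<in> ellipsoid (B k) (d k)"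
  proof -
    obtain q where q: "norm q \<le> 1" "z = d k + B k *v q"
      using z unfolding mem_ellipsoid_iff[OF B] by blast
    have "(0, axis k (1, - q)) \<in> esp_cone"
      using q(1) by (auto simp: esp_cone_alt axis_def)
    from polar(2)[OF this] show ?thesis
      by (simp add: esp_map_axis_snd q(2) inner_Pair inner_diff_right inner_add_right
          linear_neg[OF matrix_vector_mul_linear])
  qed
  have "(s, t, w) \<bullet> esp_rhs = (s, t, w) \<bullet> (s, t, w) + (s, t, w) \<bullet> esp_map A c B d xs"
    unfolding v[symmetric] by (simp add: inner_diff_right)
  then show "s + t = (norm (s, t, w))\<^sup>2"
    unfolding power2_norm_eq_inner using polar(1) by (simp add: esp_rhs_def inner_Pair)
qed

text \<open>
  The total weights of the two groups of blocks are \<open>1 - s\<close> and \<open>1 - t\<close>, so the last component of the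
  residual reads \<open>(1 - s) *\<^sub>R P - (1 - t) *\<^sub>R Q = - w\<close>.
\<close>
lemma hull_points_of_residual:
  fixes A :: "'j::finite \<Rightarrow> real^'d::finite^'d" and B :: "'l::finite \<Rightarrow> real^'d^'d"
  assumes A: "\<And>i. invertible (A i)" and B: "\<And>i. invertible (B i)" and x: "x \<in> esp_cone"
    and v: "esp_rhs - esp_map A c B d x = (s, t, w)"
  obtains P Q where "P \<in> convex hull (\<Union>i. ellipsoid (A i) (c i))"
    and "Q \<in> convex hull (\<Union>i. ellipsoid (B i) (d i))"
    and "P - Q = s *\<^sub>R P - t *\<^sub>R Q - w"
proof -
  obtain a b where x_eq: "x = (a, b)" by fastforce
  have a: "norm (snd (a $ i)) \<le> fst (a $ i)" for i using x by (auto simp: esp_cone_alt x_eq)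
  \<comment> \<open>The operator has \<open>d i\<close> and \<open>B i\<close> with opposite signs; the unit ball is symmetric.\<close>
  have b: "norm (- snd (b $ i)) \<le> fst (b $ i)" for i using x by (auto simp: esp_cone_alt x_eq)
  obtain P where P: "P \<in> convex hull (\<Union>i. ellipsoid (A i) (c i))"
    "(\<Sum>i\<in>UNIV. fst (a $ i) *\<^sub>R c i + A i *v snd (a $ i)) = (\<Sum>i\<in>UNIV. fst (a $ i)) *\<^sub>R P"
    by (rule conic_combination_in_hull[OF A a, where c = c])
  obtain Q where Q: "Q \<in> convex hull (\<Union>i. ellipsoid (B i) (d i))"
    "(\<Sum>i\<in>UNIV. fst (b $ i) *\<^sub>R d i + B i *v (- snd (b $ i))) = (\<Sum>i\<in>UNIV. fst (b $ i)) *\<^sub>R Q"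
    by (rule conic_combination_in_hull[OF B b, where c = d])
  have "B i *v (- q) = - (B i *v q)" for i q
    by (rule linear_neg[OF matrix_vector_mul_linear])
  then have "esp_map A c B d x = (\<Sum>i\<in>UNIV. fst (a $ i), \<Sum>i\<in>UNIV. fst (b $ i),
      (\<Sum>i\<in>UNIV. fst (a $ i)) *\<^sub>R P - (\<Sum>i\<in>UNIV. fst (b $ i)) *\<^sub>R Q)"
    using P(2) Q(2) by (simp add: x_eq esp_map_def)
  then have "(\<Sum>i\<in>UNIV. fst (a $ i)) = 1 - s" "(\<Sum>i\<in>UNIV. fst (b $ i)) = 1 - t"
    "(\<Sum>i\<in>UNIV. fst (a $ i)) *\<^sub>R P - (\<Sum>i\<in>UNIV. fst (b $ i)) *\<^sub>R Q = - w"
    using v by (auto simp: esp_rhs_def)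
  then have "(1 - s) *\<^sub>R P - (1 - t) *\<^sub>R Q = - w" by simp
  then have "P - Q = s *\<^sub>R P - t *\<^sub>R Q - w" by (simp add: algebra_simps)
  with P(1) Q(1) show thesis by (rule that)
qed

text \<open>
  The two hull points have norm at most 2, so their distance is at most
  \<open>\<parallel>w\<parallel> + 2 \<bar>s\<bar> + 2 \<bar>t\<bar>\<close>; the weights \<open>1, 2, 2\<close> have Euclidean norm 3.
\<close>
lemma esp_delta_le_residual:
  fixes A :: "'j::finite \<Rightarrow> real^'d::finite^'d" and B :: "'l::finite \<Rightarrow> real^'d^'d"
  assumes A: "\<And>i. invertible (A i)" and B: "\<And>i. invertible (B i)" and x: "x \<in> esp_cone"
    and C2: "\<And>i. ellipsoid (A i) (c i) \<subseteq> cball 0 2" and D2: "\<And>i. ellipsoid (B i) (d i) \<subseteq> cball 0 2"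
  shows "esp_delta A c B d \<le> 3 / 2 * norm (esp_rhs - esp_map A c B d x)"
proof -
  obtain s t w where v: "esp_rhs - esp_map A c B d x = (s, t, w)" by (metis prod_cases3)
  obtain P Q where P: "P \<in> convex hull (\<Union>i. ellipsoid (A i) (c i))"
    and Q: "Q \<in> convex hull (\<Union>i. ellipsoid (B i) (d i))"
    and PQ: "P - Q = s *\<^sub>R P - t *\<^sub>R Q - w"
    by (rule hull_points_of_residual[OF A B x v])
  have "convex hull (\<Union>i. ellipsoid (A i) (c i)) \<subseteq> cball 0 2"
    "convex hull (\<Union>i. ellipsoid (B i) (d i)) \<subseteq> cball 0 2"
    by (intro hull_minimal convex_cball UN_least C2 D2)+
  then have "norm P \<le> 2" "norm Q \<le> 2" using P Q by auto
  then have "\<bar>s\<bar> * norm P \<le> \<bar>s\<bar> * 2" "\<bar>t\<bar> * norm Q \<le> \<bar>t\<bar> * 2"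
    by (auto intro: mult_left_mono)
  then have "norm (P - Q) \<le> 1 * norm w + 2 * \<bar>s\<bar> + 2 * \<bar>t\<bar>"
    unfolding PQ using norm_triangle_ineq4[of "s *\<^sub>R P - t *\<^sub>R Q" w]
      norm_triangle_ineq4[of "s *\<^sub>R P" "t *\<^sub>R Q"] by simp
  also have "\<dots> \<le> 3 * norm (\<bar>s\<bar>, \<bar>t\<bar>, w)"
    using weighted_sum_le_norm[of 1 w 2 "\<bar>s\<bar>" 2 "\<bar>t\<bar>"] by simp
  also have "norm (\<bar>s\<bar>, \<bar>t\<bar>, w) = norm (s, t, w)" by (simp add: norm_Pair)
  finally show ?thesis using esp_delta_le_half_dist[OF P Q] by (simp add: v)
qed

section \<open>The iteration bound\<close>

lemma normalized_bounds:
  assumes "normalized A c B d"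
  shows "norm (c i) \<le> 1" and "onorm ((*v) (A i)) \<le> 1"
    and "norm (d k) \<le> 1" and "onorm ((*v) (B k)) \<le> 1"
  unfolding assms[unfolded normalized_def, symmetric] by (rule Max_ge; auto)+

theorem theorem2p4:
  fixes A :: "'j::finite \<Rightarrow> real^'d::finite^'d" and c :: "'j \<Rightarrow> real^'d"
    and B :: "'l::finite \<Rightarrow> real^'d^'d" and d :: "'l \<Rightarrow> real^'d"
    and \<sigma> :: real and v\<^sub>R :: "('d::finite, 'j, 'l) primal" and v\<^sub>D :: "'d dual"
    and x\<^sub>0 xbar :: "('d, 'j, 'l) primal" and k :: nat
  assumes "\<And>i. invertible (A i)" and "\<And>i. invertible (B i)"
    and "normalized A c B d"
    and "separable A c B d"
    and "0 < \<sigma>" and "\<sigma> < 1 / (onorm (esp_map A c B d))\<^sup>2"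
    and "infimal_displacement (esp_map A c B d) esp_rhs esp_cone \<sigma> (v\<^sub>R, v\<^sub>D)"
    and "xbar \<in> {x \<in> esp_cone. esp_rhs - esp_map A c B d x = v\<^sub>D}"
    and "real k \<ge> 54 * sqrt 2 * onorm (esp_map A c B d) * norm (x\<^sub>0 - xbar)
                    / (esp_delta A c B d)\<^sup>2 - 1"
  shows "let (s, t, w) = esp_rhs - esp_map A c B d (fista (esp_map A c B d) esp_rhs esp_cone x\<^sub>0 k);
             m = (- s + t) / 2
         in separates w m A c B d"
proof -
  let ?F = "esp_map A c B d"
  define \<delta> where "\<delta> = esp_delta A c B d"
  define xk where "xk = fista ?F esp_rhs esp_cone x\<^sub>0 k"
  have xbar: "xbar \<in> esp_cone" "esp_rhs - ?F xbar = v\<^sub>D" using assms(8) by auto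
  have min: "\<forall>u\<in>esp_cone. norm (esp_rhs - ?F xbar) \<le> norm (esp_rhs - ?F u)"
    unfolding xbar(2)
    by (intro ballI infimal_displacement_minimizes_residual[OF linear_esp_map convex_esp_cone
          closed_esp_cone _ assms(5,6,7)]) (use zero_in_esp_cone in auto)
  have F0: "0 < onorm ?F"
    using assms(5,6) onorm_pos_le[OF linear_esp_map[THEN linear_conv_bounded_linear[THEN iffD1]]]
    by (cases "onorm ?F = 0") (auto simp: less_le)
  have C2: "ellipsoid (A i) (c i) \<subseteq> cball 0 2" for i
    by (rule ellipsoid_subset_cball[OF assms(1) normalized_bounds(1,2)[OF assms(3)]])
  have D2: "ellipsoid (B i) (d i) \<subseteq> cball 0 2" for i
    by (rule ellipsoid_subset_cball[OF assms(2) normalized_bounds(3,4)[OF assms(3)]])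
  have \<delta>: "0 < \<delta>" "\<delta> \<le> 3 / 2 * norm v\<^sub>D"
    unfolding \<delta>_def xbar(2)[symmetric]
    using esp_delta_pos[OF assms(1,2,4)] esp_delta_le_residual[OF assms(1,2) xbar(1) C2 D2] by auto
  obtain s t w where v: "v\<^sub>D = (s, t, w)" by (metis prod_cases3)
  obtain s' t' w' where v': "esp_rhs - ?F xk = (s', t', w')" by (metis prod_cases3)
  note sep = minimal_residual_separation[OF assms(1,2) xbar(1) min xbar(2)[unfolded v]]
  have "norm ((s', t', w') - (s, t, w)) = norm (?F xk - ?F xbar)"
    unfolding v[symmetric] v'[symmetric] xbar(2)[symmetric] by (simp add: norm_minus_commute)
  also have "\<dots> \<le> 2 * onorm ?F * norm (x\<^sub>0 - xbar) / (real k + 1)"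
    unfolding xk_def
    by (rule fista_residual_rate[OF linear_esp_map convex_esp_cone closed_esp_cone xbar(1) F0 min])
  finally have "norm ((s', t', w') - (s, t, w)) * (real k + 1) \<le> 2 * onorm ?F * norm (x\<^sub>0 - xbar)"
    by (simp add: pos_le_divide_eq)
  then have "27 * sqrt 2 * (norm ((s', t', w') - (s, t, w)) * (real k + 1))
      \<le> 54 * sqrt 2 * onorm ?F * norm (x\<^sub>0 - xbar)"
    by (simp add: mult_ac)
  also have "\<dots> \<le> \<delta>\<^sup>2 * (real k + 1)"
  proof -
    have "54 * sqrt 2 * onorm ?F * norm (x\<^sub>0 - xbar) / \<delta>\<^sup>2 \<le> real k + 1"
      using assms(9) unfolding \<delta>_def by linarith
    then show ?thesis using \<delta>(1) by (simp add: pos_divide_le_eq mult.commute)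
  qed
  finally have "27 * sqrt 2 * norm ((s', t', w') - (s, t, w)) \<le> \<delta>\<^sup>2"
    by (simp flip: mult.assoc)
  also have "\<delta>\<^sup>2 \<le> (3 / 2 * norm v\<^sub>D)\<^sup>2" using \<delta> by (intro power_mono) auto
  also have "\<dots> = 9 / 4 * (s + t)" using sep(3) by (simp add: v power_mult_distrib power_divide)
  finally have "3 * sqrt 2 * norm ((s', t', w') - (s, t, w)) \<le> (s + t) / 4" by simp
  also have "(s + t) / 4 < s + t"
  proof -
    have "0 < norm v\<^sub>D" using \<delta> by linarith
    then have "0 < s + t" using sep(3) by (simp add: v)
    then show ?thesis by simp
  qed
  finally have near: "3 * sqrt 2 * norm ((s', t', w') - (s, t, w)) < s + t" .
  have "separates w' ((- s' + t') / 2) A c B d"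
    by (rule separates_if_near_margin[OF C2 D2 _ _ near]) (use sep(1,2) in blast)+
  then show ?thesis by (simp add: v' Let_def flip: xk_def)
qed

end
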